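(* Let $f:\mathbb{R}^n_{\ge 0}\rightarrow\mathbb{R}^n_{\ge 0}$ be an m-topical map. \begin{enumerate} \item[(1)] If $f$ is partially irreducible, then $f$ is imperturbable. \item[(2)] If $f$ is subadditive and imperturbable, then $f$ is partially irreducible. \end{enumerate}
   Context: Notation: $[n]=\{1,\dots,n\}$; $\mathbb{R}^n_{\ge 0}=[0,\infty)^n$ and $\mathbb{R}^n_{>0}=(0,\infty)^n$; $x\le y$ means $x_i\le y_i$ for all $i\in[n]$; $\mathbf{1}\in\mathbb{R}^n$ is the all-ones vector; for $J\subseteq[n]$, $e_J\in\mathbb{R}^n$ has entries $(e_J)_i=1$ if $i\in J$ and $0$ otherwise. A map $f:\mathbb{R}^n_{\ge 0}\to\mathbb{R}^n_{\ge 0}$ is m-topical (multiplicatively topical) if it is continuous, order-preserving ($x\le y$ implies $f(x)\le f(y)$), homogeneous ($f(\lambda x)=\lambda f(x)$ for all real $\lambda>0$), and satisfies $f(\mathbb{R}^n_{>0})\subseteq\mathbb{R}^n_{>0}$. $f$ is subadditive if $f(x+y)\le f(x)+f(y)$ for all $x,y\in\mathbb{R}^n_{\ge 0}$. For $J\subseteq[n]$ the part $P_J$ of the cone is $P_J=\{x\in\mathbb{R}^n_{\ge 0}: x_i>0 \text{ if and only if } i\in J\}$. An m-topical map $f$ is partially irreducible if it has no invariant parts other than the trivial parts $P_\varnothing=\{0\}$ and $P_{[n]}=\mathbb{R}^n_{>0}$, i.e. there is no $J$ with $\varnothing\neq J\subsetneq[n]$ and $f(P_J)\subseteq P_J$.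 An m-topical map $f$ is imperturbable if there are no nonempty subsets $I\subseteq J\subsetneq[n]$ such that $f(e_I)_i>0$ for all $i\in I$ and $\lim_{t\to\infty}f(\mathbf{1}+te_J)_i<\infty$ for all $i\notin J$. *)

theory Defs
  imports "HOL-Analysis.Analysis"
begin

text \<open>
  The index set \<open>[n]\<close> is an arbitrary finite type \<open>'n\<close>, so that \<open>n = CARD('n)\<close> and subsets of \<open>[n]\<close>
  are terms of type \<open>'n set\<close>.  The library order on \<open>real ^ 'n\<close> is the componentwise one, and
  \<open>1 :: real ^ 'n\<close> is the all-ones vector.

  A self-map of the closed cone is a function on \<open>real ^ 'n\<close> of which only the values on the cone
  matter; every condition below is relativised accordingly.
\<close>

definition nonneg_cone :: "(real ^ 'n::finite) set" where
  "nonneg_cone = {x. \<forall>i. 0 \<le> x $ i}"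

definition pos_cone :: "(real ^ 'n::finite) set" where
  "pos_cone = {x. \<forall>i. 0 < x $ i}"

definition char_vec :: "'n set \<Rightarrow> real ^ 'n::finite" where
  "char_vec J = (\<chi> i. if i \<in> J then 1 else 0)"

definition m_topical :: "(real ^ 'n::finite \<Rightarrow> real ^ 'n) \<Rightarrow> bool" where
  "m_topical f \<longleftrightarrow>
     f ` nonneg_cone \<subseteq> nonneg_cone \<and>
     continuous_on nonneg_cone f \<and>
     (\<forall>x\<in>nonneg_cone. \<forall>y\<in>nonneg_cone. x \<le> y \<longrightarrow> f x \<le> f y) \<and>
     (\<forall>x\<in>nonneg_cone. \<forall>c::real. 0 < c \<longrightarrow> f (c *\<^sub>R x) = c *\<^sub>R f x) \<and>
     f ` pos_cone \<subseteq> pos_cone"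

definition subadditive_on_cone :: "(real ^ 'n::finite \<Rightarrow> real ^ 'n) \<Rightarrow> bool" where
  "subadditive_on_cone f \<longleftrightarrow>
     (\<forall>x\<in>nonneg_cone. \<forall>y\<in>nonneg_cone. f (x + y) \<le> f x + f y)"

definition cone_part :: "'n set \<Rightarrow> (real ^ 'n::finite) set" where
  "cone_part J = {x \<in> nonneg_cone. \<forall>i. 0 < x $ i \<longleftrightarrow> i \<in> J}"

definition partially_irreducible :: "(real ^ 'n::finite \<Rightarrow> real ^ 'n) \<Rightarrow> bool" where
  "partially_irreducible f \<longleftrightarrow>
     \<not> (\<exists>J. J \<noteq> {} \<and> J \<subset> UNIV \<and> f ` cone_part J \<subseteq> cone_part J)"

text \<open>
  For an m-topical \<open>f\<close> each entry of \<open>f (1 + t *\<^sub>R char_vec J)\<close> is nonnegative and nondecreasing in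
  \<open>t \<ge> 0\<close>, so it always has a limit in \<open>[0, \<infinity>]\<close>; that this limit is less than \<open>\<infinity>\<close> is expressed by
  convergence to a real number.
\<close>

definition imperturbable :: "(real ^ 'n::finite \<Rightarrow> real ^ 'n) \<Rightarrow> bool" where
  "imperturbable f \<longleftrightarrow>
     \<not> (\<exists>I J. I \<noteq> {} \<and> I \<subseteq> J \<and> J \<subset> UNIV \<and>
          (\<forall>i\<in>I. 0 < f (char_vec I) $ i) \<and>
          (\<forall>i. i \<notin> J \<longrightarrow>
             (\<exists>L::real. ((\<lambda>t::real. f (1 + t *\<^sub>R char_vec J) $ i) \<longlongrightarrow> L) at_top)))"

end

theory Submission
  imports Defs
begin

text \<open>
  By homogeneity and monotonicity the support of \<open>f x\<close> depends only, and monotonically, on the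
  support of \<open>x\<close>. Given witnesses \<open>I \<subseteq> J\<close> against imperturbability, the support map sends \<open>I\<close> to a
  superset of \<open>I\<close> and, since \<open>t * f e\<^sub>J \<le> f (1 + t * e\<^sub>J)\<close>, \<open>J\<close> to a subset of \<open>J\<close>; so it has a
  fixed point between \<open>I\<close> and \<open>J\<close>, which is an invariant part. Conversely, if \<open>P\<^sub>J\<close> is invariant and
  \<open>f\<close> is subadditive, then \<open>f (1 + t * e\<^sub>J)\<close> agrees with \<open>f 1\<close> outside \<open>J\<close> for all \<open>t \<ge> 0\<close>, and
  \<open>I = J\<close> witnesses that \<open>f\<close> is not imperturbable.
\<close>

text \<open>The action of \<open>f\<close> on parts, computed at the single representative
  \<open>char_vec K\<close> of \<open>cone_part K\<close>. For m-topical \<open>f\<close> the choice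
  of representative does not matter.\<close>

definition support_map :: "(real ^ 'n::finite \<Rightarrow> real ^ 'n) \<Rightarrow> 'n set \<Rightarrow> 'n set" where
  "support_map f K = {i. 0 < f (char_vec K) $ i}"

lemma char_vec_nth [simp]: "char_vec J $ i = (if i \<in> J then 1 else 0)"
  by (simp add: char_vec_def)

lemma char_vec_in_cone [simp]: "char_vec J \<in> nonneg_cone"
  by (simp add: nonneg_cone_def)

lemma one_plus_char_vec_in_cone: "0 \<le> t \<Longrightarrow> 1 + t *\<^sub>R char_vec J \<in> nonneg_cone"
  by (simp add: nonneg_cone_def)

lemma scaleR_in_cone: "x \<in> nonneg_cone \<Longrightarrow> 0 \<le> c \<Longrightarrow> c *\<^sub>R x \<in> nonneg_cone"
  by (simp add: nonneg_cone_def)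

lemma m_topical_nonneg: "m_topical f \<Longrightarrow> x \<in> nonneg_cone \<Longrightarrow> 0 \<le> f x $ i"
  by (auto simp: m_topical_def nonneg_cone_def)

lemma m_topical_mono:
  assumes "m_topical f" "x \<in> nonneg_cone" "y \<in> nonneg_cone" "x \<le> y"
  shows "f x $ i \<le> f y $ i"
  using assms by (auto simp: m_topical_def less_eq_vec_def)

lemma m_topical_scaleR:
  assumes "m_topical f" "x \<in> nonneg_cone" "0 < c"
  shows "f (c *\<^sub>R x) = c *\<^sub>R f x"
  using assms by (auto simp: m_topical_def)

text \<open>Turns an inclusion of supports into an inequality up to a scalar, the form that
  monotonicity and homogeneity can use. Since there are finitely many coordinates, the sum of all
  ratios bounds each of them.\<close>

lemma nonneg_cone_dominated:
  assumes x: "x \<in> nonneg_cone" and y: "y \<in> nonneg_cone"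
    and supp: "\<And>i. 0 < y $ i \<Longrightarrow> 0 < x $ i"
  obtains c where "0 < c" "y \<le> c *\<^sub>R x"
proof
  \<comment> \<open>A coordinate with \<open>x $ i = 0\<close> contributes \<open>y $ i / 0 = 0\<close>.\<close>
  define c where "c = 1 + (\<Sum>i\<in>UNIV. y $ i / x $ i)"
  have nn: "0 \<le> y $ i / x $ i" for i
    using x y by (simp add: nonneg_cone_def)
  have "0 \<le> (\<Sum>i\<in>UNIV. y $ i / x $ i)"
    by (rule sum_nonneg) (rule nn)
  then show "0 < c"
    by (simp add: c_def)
  have "y $ i \<le> c * x $ i" for i
  proof (cases "0 < x $ i")
    case True
    have "y $ i / x $ i \<le> c"
      unfolding c_def using member_le_sum[of i UNIV "\<lambda>i. y $ i / x $ i"] nn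
      by simp
    with True show ?thesis by (simp add: field_simps)
  next
    case False
    with supp[of i] have "\<not> 0 < y $ i" by blast
    moreover have "0 \<le> c * x $ i"
      using x \<open>0 < c\<close> by (simp add: nonneg_cone_def)
    ultimately show ?thesis by linarith
  qed
  then show "y \<le> c *\<^sub>R x" by (simp add: less_eq_vec_def)
qed

text \<open>From \<open>y \<le> c *\<^sub>R x\<close> follows
  \<open>f y \<le> c *\<^sub>R f x\<close>, and the factor \<open>c > 0\<close> does not affect
  signs.\<close>

lemma m_topical_support_mono:
  assumes f: "m_topical f" and x: "x \<in> nonneg_cone" and y: "y \<in> nonneg_cone"
    and supp: "\<And>i. 0 < y $ i \<Longrightarrow> 0 < x $ i" and pos: "0 < f y $ j"
  shows "0 < f x $ j"
proof -
  obtain c where c: "0 < c" "y \<le> c *\<^sub>R x"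
    using nonneg_cone_dominated[OF x y supp] .
  have "f y $ j \<le> c * f x $ j"
    using m_topical_mono[OF f y scaleR_in_cone[OF x] c(2)] c(1) m_topical_scaleR[OF f x c(1)]
    by simp
  with pos c(1) show ?thesis
    by (smt (verit) mult_nonneg_nonpos)
qed

lemma mono_support_map:
  assumes "m_topical f"
  shows "mono (support_map f)"
proof (rule monoI, rule subsetI)
  fix K L i assume KL: "K \<subseteq> L" and i: "i \<in> support_map f K"
  have "0 < f (char_vec L) $ i"
    by (rule m_topical_support_mono[OF assms char_vec_in_cone char_vec_in_cone, of K])
      (use KL i in \<open>auto simp: support_map_def split: if_splits\<close>)
  then show "i \<in> support_map f L" by (simp add: support_map_def)
qed

text \<open>A point of \<open>cone_part K\<close> and \<open>char_vec K\<close> have the same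
  support, so support monotonicity applied in both directions gives their images the same
  support.\<close>

lemma support_map_fixed_imp_invariant:
  assumes f: "m_topical f" and K: "support_map f K = K"
  shows "f ` cone_part K \<subseteq> cone_part K"
proof (rule image_subsetI)
  fix x assume "x \<in> cone_part K"
  then have x: "x \<in> nonneg_cone" and supp: "\<And>i. 0 < x $ i \<longleftrightarrow> i \<in> K"
    by (auto simp: cone_part_def)
  have "0 < f x $ i \<longleftrightarrow> 0 < f (char_vec K) $ i" for i
  proof
    assume "0 < f x $ i"
    then show "0 < f (char_vec K) $ i"
      by (rule m_topical_support_mono[OF f char_vec_in_cone x, rotated]) (simp add: supp)
  next
    assume "0 < f (char_vec K) $ i"
    then show "0 < f x $ i"
      by (rule m_topical_support_mono[OF f x char_vec_in_cone, rotated])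
        (simp add: supp split: if_splits)
  qed
  then show "f x \<in> cone_part K"
    using K m_topical_nonneg[OF f x] by (auto simp: cone_part_def nonneg_cone_def support_map_def)
qed

text \<open>A coordinate outside \<open>J\<close> where \<open>f (char_vec J)\<close> is positive
  would grow at least linearly in \<open>t\<close>, against the finite limit.\<close>

lemma support_map_subset_if_convergent:
  assumes f: "m_topical f"
    and conv: "\<And>i. i \<notin> J \<Longrightarrow> \<exists>L::real. ((\<lambda>t::real. f (1 + t *\<^sub>R char_vec J) $ i) \<longlongrightarrow> L) at_top"
  shows "support_map f J \<subseteq> J"
proof (rule subsetI, rule ccontr)
  fix i assume i: "i \<in> support_map f J" and "i \<notin> J"
  then obtain L :: real where L: "((\<lambda>t::real. f (1 + t *\<^sub>R char_vec J) $ i) \<longlongrightarrow> L) at_top"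
    using conv by blast
  have pos: "0 < f (char_vec J) $ i" using i by (simp add: support_map_def)
  have "t * f (char_vec J) $ i \<le> f (1 + t *\<^sub>R char_vec J) $ i" if "0 < t" for t
    using m_topical_mono[OF f scaleR_in_cone[OF char_vec_in_cone] one_plus_char_vec_in_cone,
        of t t J J i] that
    by (simp add: m_topical_scaleR[OF f] less_eq_vec_def)
  then have ev: "\<forall>\<^sub>F t in at_top. t * f (char_vec J) $ i \<le> f (1 + t *\<^sub>R char_vec J) $ i"
    by (rule eventually_mono[OF eventually_gt_at_top[of 0]])
  have "filterlim (\<lambda>t::real. t * f (char_vec J) $ i) at_top at_top"
    using pos by (intro filterlim_at_top_mult_tendsto_pos[OF tendsto_const] filterlim_ident)
  then have "filterlim (\<lambda>t::real. f (1 + t *\<^sub>R char_vec J) $ i) at_top at_top"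
    using ev by (rule filterlim_at_top_mono)
  with L show False
    using not_tendsto_and_filterlim_at_infinity[OF trivial_limit_at_top_linorder]
      filterlim_at_top_imp_at_infinity by blast
qed

lemma partially_irreducible_imp_imperturbable:
  assumes f: "m_topical f" and irr: "partially_irreducible f"
  shows "imperturbable f"
  unfolding imperturbable_def
proof (rule notI, elim exE conjE)
  fix I J
  assume I: "I \<noteq> {}" "I \<subseteq> J" and J: "J \<subset> UNIV"
    and pos: "\<forall>i\<in>I. 0 < f (char_vec I) $ i"
    and conv: "\<forall>i. i \<notin> J \<longrightarrow>
      (\<exists>L::real. ((\<lambda>t::real. f (1 + t *\<^sub>R char_vec J) $ i) \<longlongrightarrow> L) at_top)"
  note mono = mono_support_map[OF f]
  \<comment> \<open>The union with \<open>I\<close> keeps the fixed point nonempty: homogeneity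
    forces \<open>f 0 = 0\<close>, so the least fixed point of \<open>support_map f\<close> alone is
    empty.\<close>
  define K where "K = lfp (\<lambda>K. I \<union> support_map f K)"
  have "mono (\<lambda>K. I \<union> support_map f K)"
    using mono by (auto simp: mono_def)
  then have K: "K = I \<union> support_map f K"
    unfolding K_def by (rule lfp_unfold)
  have "I \<subseteq> support_map f I" using pos by (auto simp: support_map_def)
  also have "\<dots> \<subseteq> support_map f K" using K by (intro monoD[OF mono]) blast
  finally have fixed: "support_map f K = K" using K by blast
  \<comment> \<open>\<open>J\<close> is a pre-fixed point: it contains both \<open>I\<close> and
    \<open>support_map f J\<close>.\<close>
  have "K \<subseteq> J"
    unfolding K_def using I(2) support_map_subset_if_convergent[OF f] conv
    by (intro lfp_lowerbound) blast
  show False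
  proof -
    have "K \<noteq> {}" using K I(1) by blast
    moreover have "K \<subset> UNIV" using \<open>K \<subseteq> J\<close> J by (rule subset_psubset_trans)
    ultimately show False
      using irr support_map_fixed_imp_invariant[OF f fixed]
      unfolding partially_irreducible_def by blast
  qed
qed

lemma subadditive_imperturbable_imp_partially_irreducible:
  assumes f: "m_topical f" and sub: "subadditive_on_cone f" and imp: "imperturbable f"
  shows "partially_irreducible f"
  unfolding partially_irreducible_def
proof (rule notI, elim exE conjE)
  fix J
  assume J: "J \<noteq> {}" "J \<subset> UNIV" and inv: "f ` cone_part J \<subseteq> cone_part J"
  have "char_vec J \<in> cone_part J" by (simp add: cone_part_def)
  then have fJ: "f (char_vec J) \<in> cone_part J" using inv by blast
  have one: "(1 :: real ^ 'a) \<in> nonneg_cone" by (simp add: nonneg_cone_def)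
  have "((\<lambda>t::real. f (1 + t *\<^sub>R char_vec J) $ i) \<longlongrightarrow> f 1 $ i) at_top" if i: "i \<notin> J" for i
  proof (rule tendsto_eventually)
    have zero: "f (char_vec J) $ i = 0"
      using fJ i by (auto simp: cone_part_def nonneg_cone_def order.order_iff_strict)
    have "f (1 + t *\<^sub>R char_vec J) $ i = f 1 $ i" if t: "0 < t" for t
    proof (rule antisym)
      have "f (1 + t *\<^sub>R char_vec J) \<le> f 1 + f (t *\<^sub>R char_vec J)"
        using sub one scaleR_in_cone[OF char_vec_in_cone, of t J] t
        unfolding subadditive_on_cone_def by simp
      then have "f (1 + t *\<^sub>R char_vec J) $ i \<le> f 1 $ i + f (t *\<^sub>R char_vec J) $ i"
        by (simp add: less_eq_vec_def)
      \<comment> \<open>By homogeneity the subadditive error is \<open>t\<close> times the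
        coordinate of \<open>f (char_vec J)\<close> at \<open>i\<close>, which vanishes because
        \<open>i\<close> lies outside the invariant part.\<close>
      then show "f (1 + t *\<^sub>R char_vec J) $ i \<le> f 1 $ i"
        by (simp add: m_topical_scaleR[OF f _ t] zero)
      show "f 1 $ i \<le> f (1 + t *\<^sub>R char_vec J) $ i"
        using t by (intro m_topical_mono[OF f one one_plus_char_vec_in_cone])
          (auto simp: less_eq_vec_def)
    qed
    then show "\<forall>\<^sub>F t in at_top. f (1 + t *\<^sub>R char_vec J) $ i = f 1 $ i"
      by (rule eventually_mono[OF eventually_gt_at_top[of 0]])
  qed
  then have conv: "\<forall>i. i \<notin> J \<longrightarrow>
      (\<exists>L::real. ((\<lambda>t::real. f (1 + t *\<^sub>R char_vec J) $ i) \<longlongrightarrow> L) at_top)"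
    by blast
  have pos: "\<forall>i\<in>J. 0 < f (char_vec J) $ i"
    using fJ by (auto simp: cone_part_def)
  show False
    using imp unfolding imperturbable_def
    by (rule notE) (intro exI[of _ J] conjI J pos conv subset_refl)
qed

theorem theorem3p5:
  fixes f :: "real ^ 'n::finite \<Rightarrow> real ^ 'n"
  assumes "m_topical f"
  shows "(partially_irreducible f \<longrightarrow> imperturbable f) \<and>
         (subadditive_on_cone f \<and> imperturbable f \<longrightarrow> partially_irreducible f)"
  using partially_irreducible_imp_imperturbable[OF assms]
    subadditive_imperturbable_imp_partially_irreducible[OF assms] by blast

end
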